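(* Let nodal values $u_1,\ldots,u_{N_h}\in\mathcal G$ be given, and let all quantities $d_{ij}^{e,\max}$, $f_{ij}^{e,**}$, $\mathbf{f}_i$, $u_i^{\min}$, $u_i^{\max}$ be computed from them as defined in the context. Consider the flux-corrected continuous Galerkin semi-discretization $$m_i\frac{\mathrm{d}u_i}{\mathrm{d}t}=\sum_{e\in\mathcal E_i}\sum_{j\in\mathcal N^e\setminus\{i\}}\left[d_{ij}^{e,\max}(u_j-u_i)+f_{ij}^{e,**}-\mathbf{c}_{ij}^e\cdot(\mathbf{f}_j-\mathbf{f}_i)\right],\qquad i=1,\ldots,N_h.$$ Then an explicit strong stability preserving (SSP) Runge--Kutta time discretization of this system satisfies the following local maximum principle. Let $$\bar u_i=u_i+\frac{\Delta t}{m_i}\sum_{e\in\mathcal E_i}\sum_{j\in\mathcal N^e\setminus\{i\}}\left[d_{ij}^{e,\max}(u_j-u_i)+f_{ij}^{e,**}-\mathbf{c}_{ij}^e\cdot(\mathbf{f}_j-\mathbf{f}_i)\right]$$ be the result of a (forward Euler) stage with time step $\Delta t>0$ applied to the nodal values $u_1,\ldots,u_{N_h}$. Then $$u_i^{\min}\le\bar u_i\le u_i^{\max}$$ under the time step restriction $$\Delta t\sum_{e\in\mathcal E_i}\sum_{j\in\mathcal N^e\setminus\{i\}}2d_{ij}^{e,\max}\le m_i .$$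
   Context: **Continuous problem.** Let $d\in\{1,2,3\}$, and let $\mathcal G\subset\mathbb{R}$ be a convex set (interval). Consider the scalar conservation law $\partial_t u+\nabla\cdot\mathbf{f}(u)=0$ with a continuously differentiable flux $\mathbf{f}:\mathcal G\to\mathbb{R}^d$. Let $(\eta,\mathbf{q})$ be an entropy pair: $\eta:\mathcal G\to\mathbb{R}$ is convex and twice continuously differentiable, $v=\eta'$ is the entropy variable, and $\mathbf{q}:\mathcal G\to\mathbb{R}^d$ is differentiable with $v(u)\mathbf{f}'(u)=\mathbf{q}'(u)$. Put $\boldsymbol{\psi}(u)=v(u)\mathbf{f}(u)-\mathbf{q}(u)$. **Finite element notation.** The bounded spatial domain $\Omega\subset\mathbb{R}^d$, with periodic boundary conditions, is discretized by a conforming mesh $\{K_1,\ldots,K_{E_h}\}$ of linear ($\mathbb{P}_1$) or multilinear ($\mathbb{Q}_1$) finite elements, with element $K^e$ denoting the one with index $e$. The vertices are $\mathbf{x}_1,\ldots,\mathbf{x}_{N_h}$, and $\varphi_1,\ldots,\varphi_{N_h}$ are the associated globally continuous nodal basis functions. $\mathcal E_i$ is the set of indices of elements containing $\mathbf{x}_i$; $\mathcal N^e$ is the set of indices of nodes belonging to $K^e$; $\mathcal N_i=\bigcup_{e\in\mathcal E_i}\mathcal N^e$. Define $$m_{ij}^e=\int_{K^e}\varphi_i\varphi_j\,\mathrm{d}\mathbf{x},\quad \mathbf{c}_{ij}^e=\int_{K^e}\varphi_i\nabla\varphi_j\,\mathrm{d}\mathbf{x},\quad m_i^e=\sum_{j\in\mathcal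 N^e}m_{ij}^e=\int_{K^e}\varphi_i\,\mathrm{d}\mathbf{x}>0,\quad m_i=\sum_{e\in\mathcal E_i}m_i^e .$$ Note $\sum_{j\in\mathcal N^e}\varphi_j=1$ on $K^e$. **Nodal quantities.** For nodal values $u_i\in\mathcal G$ write $\mathbf{f}_i=\mathbf{f}(u_i)$, $v_i=v(u_i)$. Convention: any quotient with zero denominator is read as $0$. For $i\in\mathcal N^e$, $j\in\mathcal N^e\setminus\{i\}$ define the following. 1. Maximal-speed diffusion coefficient: $$d_{ij}^{e,\max}=\max\{|\mathbf{c}_{ij}^e|,|\mathbf{c}_{ji}^e|\}\max\{\lambda_{ij}^{\max},\lambda_{ji}^{\max}\},\quad \lambda_{ij}^{\max}=\max_{\omega\in[0,1]}\left|\mathbf{n}_{ij}^e\cdot\mathbf{f}'(\omega u_i+(1-\omega)u_j)\right|,\quad \mathbf{n}_{ij}^e=\frac{\mathbf{c}_{ij}^e}{|\mathbf{c}_{ij}^e|}.$$ 2. Minimal diffusion coefficient: with $$Q_{ij}^e=2\mathbf{c}_{ij}^e\cdot\left[\boldsymbol{\psi}(u_j)-\boldsymbol{\psi}(u_i)+(v_i-v_j)\frac{\mathbf{f}_j+\mathbf{f}_i}{2}\right],$$ set $$d_{ij}^{e,\min}=\frac{\min\{Q_{ij}^e,0,Q_{ji}^e\}}{(v_i-v_j)(u_j-u_i)}\ \text{ if } u_i\neq u_j,\qquad d_{ij}^{e,\min}=0\ \text{ if } u_i=u_j.$$ 3. Entropy viscosity coefficient: $$\nu_{ij}^e=\max\left\{\frac{\mathbf{c}_{ij}^e\cdot\left[\mathbf{f}_j+\mathbf{f}_i-2\mathbf{f}\left(\frac{u_j+u_i}{2}\right)\right]}{v_j-v_i},\,0,\,\frac{\mathbf{c}_{ji}^e\cdot\left[\mathbf{f}_j+\mathbf{f}_i-2\mathbf{f}\left(\frac{u_j+u_i}{2}\right)\right]}{v_i-v_j}\right\}.$$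 4. Approximate time derivatives: $$\dot u_i=\frac{1}{m_i}\sum_{e\in\mathcal E_i}\sum_{j\in\mathcal N^e\setminus\{i\}}\left[d_{ij}^{e,\max}(u_j-u_i)-\mathbf{c}_{ij}^e\cdot(\mathbf{f}_j-\mathbf{f}_i)\right].$$ 5. Raw antidiffusive fluxes: $$f_{ij}^e=m_{ij}^e(\dot u_i-\dot u_j)+(d_{ij}^{e,\min}-d_{ij}^{e,\max})(u_j-u_i)+\nu_{ij}^e(v_j-v_i).$$ 6. Local bounds: $u_i^{\min}=\min_{j\in\mathcal N_i}u_j$, $\ u_i^{\max}=\max_{j\in\mathcal N_i}u_j$. 7. Bar states: $$\bar u_{ij}^e=\frac{u_j+u_i}{2}-\frac{\mathbf{c}_{ij}^e\cdot(\mathbf{f}_j-\mathbf{f}_i)}{2d_{ij}^{e,\max}}.$$ 8. Bound-preserving fluxes: $$f_{ij}^{e,*}=\begin{cases}\min\left\{f_{ij}^e,\,2d_{ij}^{e,\max}\min\{u_i^{\max}-\bar u_{ij}^e,\ \bar u_{ji}^e-u_j^{\min}\}\right\}&\text{if } f_{ij}^e>0,\\ \max\left\{f_{ij}^e,\,2d_{ij}^{e,\max}\max\{u_i^{\min}-\bar u_{ij}^e,\ \bar u_{ji}^e-u_j^{\max}\}\right\}&\text{otherwise.}\end{cases}$$ 9. Entropy-corrected fluxes: with $Q_{ij}^{e,*}=Q_{ij}^e-(v_j-v_i)d_{ij}^{e,\max}(u_i-u_j)$, $$f_{ij}^{e,**}=\begin{cases}\dfrac{\min\{Q_{ij}^{e,*},\,(v_i-v_j)f_{ij}^{e,*},\,Q_{ji}^{e,*}\}}{v_i-v_j}&\text{if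 }(v_i-v_j)f_{ij}^{e,*}>0,\\ f_{ij}^{e,*}&\text{otherwise.}\end{cases}$$ **Time discretization.** Each stage of an explicit SSP Runge--Kutta method is a forward Euler update of the form written in the claim (combined with convex averaging); $u_i$ denotes the input nodal values of the stage, and $\bar u_i$ (single index) denotes the result of the forward Euler update. *)

theory Defs
  imports "HOL-Analysis.Analysis"
begin

section \<open>Conservation law and entropy pair\<close>

text \<open>All derivatives with respect to the state are taken within the state interval, so that they
  are one-sided at end points belonging to it.  (The library's \<open>C1_differentiable_on\<close> would
  refer to values outside the interval.)\<close>

definition deriv_in :: "real set \<Rightarrow> (real \<Rightarrow> 'b::real_normed_vector) \<Rightarrow> real \<Rightarrow> 'b" where
  "deriv_in G g w = vector_derivative g (at w within G)"

definition C1_in :: "real set \<Rightarrow> (real \<Rightarrow> 'b::real_normed_vector) \<Rightarrow> bool" where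
  "C1_in G g \<longleftrightarrow> (\<forall>w\<in>G. g differentiable (at w within G)) \<and> continuous_on G (deriv_in G g)"

record ('d::finite) law =
  states :: "real set"
  flux :: "real \<Rightarrow> real^'d"
  entropy :: "real \<Rightarrow> real"
  entropy_flux :: "real \<Rightarrow> real^'d"

definition flux_deriv :: "('d::finite) law \<Rightarrow> real \<Rightarrow> real^'d" where
  "flux_deriv P = deriv_in (states P) (flux P)"

definition entropy_var :: "('d::finite) law \<Rightarrow> real \<Rightarrow> real" where
  "entropy_var P = deriv_in (states P) (entropy P)"

definition entropy_potential :: "('d::finite) law \<Rightarrow> real \<Rightarrow> real^'d" where
  "entropy_potential P w = entropy_var P w *\<^sub>R flux P w - entropy_flux P w"

definition conservation_law :: "('d::finite) law \<Rightarrow> bool" where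
  "conservation_law P \<longleftrightarrow>
     convex (states P) \<and>
     C1_in (states P) (flux P) \<and>
     convex_on (states P) (entropy P) \<and>
     C1_in (states P) (entropy P) \<and>
     C1_in (states P) (entropy_var P) \<and>
     (\<forall>w\<in>states P. (entropy_flux P has_vector_derivative (entropy_var P w *\<^sub>R flux_deriv P w))
                       (at w within states P))"


section \<open>Periodic conforming meshes of linear and multilinear elements\<close>

datatype elem_kind = P1 | Q1

definition ref_elem :: "elem_kind \<Rightarrow> (real^'d::finite) set" where
  "ref_elem t = (case t of
      P1 \<Rightarrow> {\<xi>. (\<forall>k. 0 \<le> \<xi> $ k) \<and> (\<Sum>k\<in>UNIV. \<xi> $ k) \<le> 1}
    | Q1 \<Rightarrow> {\<xi>. \<forall>k. 0 \<le> \<xi> $ k \<and> \<xi> $ k \<le> 1})"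

definition shape_fun :: "elem_kind \<Rightarrow> (real^'d::finite \<Rightarrow> real) \<Rightarrow> bool" where
  "shape_fun t p = (case t of
      P1 \<Rightarrow> (\<exists>a b. \<forall>\<xi>. p \<xi> = a + b \<bullet> \<xi>)
    | Q1 \<Rightarrow> (\<exists>a. \<forall>\<xi>. p \<xi> = (\<Sum>S\<in>Pow UNIV. a S * (\<Prod>k\<in>S. \<xi> $ k))))"

text \<open>Elements are indexed by \<open>1, \<dots>, num_elems\<close> and nodes by \<open>1, \<dots>, num_nodes\<close>.  The element
  with index \<open>e\<close> is the image of the reference simplex or reference cube under \<open>ref_map M e\<close>.
  Periodic boundary conditions are encoded by \<open>period\<close>: points that differ by an integer
  combination of the period vectors are identified.  A node is thus a class of congruent
  vertices; \<open>node\<close> selects a representative.  Basis functions are periodic functions on the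
  whole space.\<close>

record ('d::finite) mesh =
  domain :: "(real^'d) set"
  period :: "'d \<Rightarrow> real^'d"
  num_elems :: nat
  kind :: "nat \<Rightarrow> elem_kind"
  ref_map :: "nat \<Rightarrow> real^'d \<Rightarrow> real^'d"
  num_nodes :: nat
  node :: "nat \<Rightarrow> real^'d"
  phi :: "nat \<Rightarrow> real^'d \<Rightarrow> real"

definition elems :: "('d::finite) mesh \<Rightarrow> nat set" where
  "elems M = {1..num_elems M}"

definition nodes :: "('d::finite) mesh \<Rightarrow> nat set" where
  "nodes M = {1..num_nodes M}"

definition lattice :: "('d::finite) mesh \<Rightarrow> (real^'d) set" where
  "lattice M = {\<Sum>k\<in>UNIV. real_of_int (z k) *\<^sub>R period M k | z. True}"

definition elem :: "('d::finite) mesh \<Rightarrow> nat \<Rightarrow> (real^'d) set" where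
  "elem M e = ref_map M e ` ref_elem (kind M e)"

definition elem_vertices :: "('d::finite) mesh \<Rightarrow> nat \<Rightarrow> (real^'d) set" where
  "elem_vertices M e = ref_map M e ` {\<xi>. \<xi> extreme_point_of ref_elem (kind M e)}"

text \<open>The domain is a bounded fundamental domain of the period lattice, for instance a box with
  opposite sides identified.\<close>

definition periodic_domain :: "('d::finite) mesh \<Rightarrow> bool" where
  "periodic_domain M \<longleftrightarrow>
     inj (period M) \<and> independent (range (period M)) \<and>
     domain M \<noteq> {} \<and> open (domain M) \<and> connected (domain M) \<and> bounded (domain M) \<and>
     (\<forall>l\<in>lattice M. l \<noteq> 0 \<longrightarrow> domain M \<inter> (+) l ` domain M = {}) \<and>
     (\<Union>l\<in>lattice M. (+) l ` closure (domain M)) = UNIV"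

definition admissible_elem :: "('d::finite) mesh \<Rightarrow> nat \<Rightarrow> bool" where
  "admissible_elem M e \<longleftrightarrow>
     (\<forall>k. shape_fun (kind M e) (\<lambda>\<xi>. ref_map M e \<xi> $ k)) \<and>
     inj_on (ref_map M e) (ref_elem (kind M e))"

text \<open>Conformity of the periodically extended mesh: any two distinct elements, up to periodic
  translation, meet in a common proper (possibly empty) face.\<close>

definition conforming :: "('d::finite) mesh \<Rightarrow> bool" where
  "conforming M \<longleftrightarrow>
     (\<forall>e\<in>elems M. \<forall>e'\<in>elems M. \<forall>l\<in>lattice M. e \<noteq> e' \<or> l \<noteq> 0 \<longrightarrow>
        (\<exists>T T'. T face_of ref_elem (kind M e) \<and> T \<noteq> ref_elem (kind M e) \<and>
                T' face_of ref_elem (kind M e') \<and> T' \<noteq> ref_elem (kind M e') \<and>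
                elem M e \<inter> (+) l ` elem M e' = ref_map M e ` T \<and>
                elem M e \<inter> (+) l ` elem M e' = (+) l ` ref_map M e' ` T'))"

definition nodes_are_vertices :: "('d::finite) mesh \<Rightarrow> bool" where
  "nodes_are_vertices M \<longleftrightarrow>
     (\<forall>i\<in>nodes M. \<exists>e\<in>elems M. node M i \<in> elem_vertices M e) \<and>
     (\<forall>e\<in>elems M. \<forall>p\<in>elem_vertices M e. \<exists>!i. i \<in> nodes M \<and> p - node M i \<in> lattice M)"

definition nodal_basis :: "('d::finite) mesh \<Rightarrow> bool" where
  "nodal_basis M \<longleftrightarrow>
     (\<forall>i\<in>nodes M.
        continuous_on UNIV (phi M i) \<and>
        (\<forall>x. \<forall>l\<in>lattice M. phi M i (x + l) = phi M i x) \<and>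
        (\<forall>e\<in>elems M. \<exists>p. shape_fun (kind M e) p \<and>
             (\<forall>\<xi>\<in>ref_elem (kind M e). phi M i (ref_map M e \<xi>) = p \<xi>)) \<and>
        (\<forall>j\<in>nodes M. phi M i (node M j) = (if i = j then 1 else 0)))"

definition fe_mesh :: "('d::finite) mesh \<Rightarrow> bool" where
  "fe_mesh M \<longleftrightarrow>
     periodic_domain M \<and>
     (\<forall>e\<in>elems M. admissible_elem M e) \<and>
     (\<Union>e\<in>elems M. elem M e) = closure (domain M) \<and>
     conforming M \<and> nodes_are_vertices M \<and> nodal_basis M"

definition elems_of_node :: "('d::finite) mesh \<Rightarrow> nat \<Rightarrow> nat set" where
  "elems_of_node M i = {e \<in> elems M. \<exists>l\<in>lattice M. node M i + l \<in> elem M e}"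

definition nodes_of_elem :: "('d::finite) mesh \<Rightarrow> nat \<Rightarrow> nat set" where
  "nodes_of_elem M e = {i \<in> nodes M. \<exists>l\<in>lattice M. node M i + l \<in> elem M e}"

definition neighbours :: "('d::finite) mesh \<Rightarrow> nat \<Rightarrow> nat set" where
  "neighbours M i = (\<Union>e\<in>elems_of_node M i. nodes_of_elem M e)"

text \<open>Basis functions need not be differentiable on element boundaries; these form a null set
  and do not affect the integrals below.\<close>

definition grad :: "(real^'d::finite \<Rightarrow> real) \<Rightarrow> real^'d \<Rightarrow> real^'d" where
  "grad g x = (THE D. GDERIV g x :> D)"

definition mass :: "('d::finite) mesh \<Rightarrow> nat \<Rightarrow> nat \<Rightarrow> nat \<Rightarrow> real" where
  "mass M e i j = integral (elem M e) (\<lambda>x. phi M i x * phi M j x)"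

definition cvec :: "('d::finite) mesh \<Rightarrow> nat \<Rightarrow> nat \<Rightarrow> nat \<Rightarrow> real^'d" where
  "cvec M e i j = integral (elem M e) (\<lambda>x. phi M i x *\<^sub>R grad (phi M j) x)"

definition lumped_elem_mass :: "('d::finite) mesh \<Rightarrow> nat \<Rightarrow> nat \<Rightarrow> real" where
  "lumped_elem_mass M e i = (\<Sum>j\<in>nodes_of_elem M e. mass M e i j)"

definition lumped_mass :: "('d::finite) mesh \<Rightarrow> nat \<Rightarrow> real" where
  "lumped_mass M i = (\<Sum>e\<in>elems_of_node M i. lumped_elem_mass M e i)"


section \<open>Flux-corrected scheme\<close>

text \<open>The zero-denominator convention for quotients is that of the library, \<open>x / 0 = 0\<close>.\<close>

definition nvec :: "('d::finite) mesh \<Rightarrow> nat \<Rightarrow> nat \<Rightarrow> nat \<Rightarrow> real^'d" where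
  "nvec M e i j = cvec M e i j /\<^sub>R norm (cvec M e i j)"

text \<open>The supremum is attained, since the flux derivative is continuous on the segment.\<close>

definition lambda_max ::
  "('d::finite) mesh \<Rightarrow> 'd law \<Rightarrow> (nat \<Rightarrow> real) \<Rightarrow> nat \<Rightarrow> nat \<Rightarrow> nat \<Rightarrow> real" where
  "lambda_max M P u e i j =
     (SUP \<omega>\<in>{0..1}. \<bar>nvec M e i j \<bullet> flux_deriv P (\<omega> * u i + (1 - \<omega>) * u j)\<bar>)"

definition d_max ::
  "('d::finite) mesh \<Rightarrow> 'd law \<Rightarrow> (nat \<Rightarrow> real) \<Rightarrow> nat \<Rightarrow> nat \<Rightarrow> nat \<Rightarrow> real" where
  "d_max M P u e i j =
     max (norm (cvec M e i j)) (norm (cvec M e j i)) *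
     max (lambda_max M P u e i j) (lambda_max M P u e j i)"

definition Q ::
  "('d::finite) mesh \<Rightarrow> 'd law \<Rightarrow> (nat \<Rightarrow> real) \<Rightarrow> nat \<Rightarrow> nat \<Rightarrow> nat \<Rightarrow> real" where
  "Q M P u e i j =
     2 * (cvec M e i j \<bullet>
       (entropy_potential P (u j) - entropy_potential P (u i) +
        (entropy_var P (u i) - entropy_var P (u j)) *\<^sub>R ((flux P (u j) + flux P (u i)) /\<^sub>R 2)))"

definition d_min ::
  "('d::finite) mesh \<Rightarrow> 'd law \<Rightarrow> (nat \<Rightarrow> real) \<Rightarrow> nat \<Rightarrow> nat \<Rightarrow> nat \<Rightarrow> real" where
  "d_min M P u e i j =
     (if u i \<noteq> u j
      then Min {Q M P u e i j, 0, Q M P u e j i} /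
           ((entropy_var P (u i) - entropy_var P (u j)) * (u j - u i))
      else 0)"

definition entropy_visc ::
  "('d::finite) mesh \<Rightarrow> 'd law \<Rightarrow> (nat \<Rightarrow> real) \<Rightarrow> nat \<Rightarrow> nat \<Rightarrow> nat \<Rightarrow> real" where
  "entropy_visc M P u e i j =
     (let g = flux P (u j) + flux P (u i) - 2 *\<^sub>R flux P ((u j + u i) / 2)
      in Max {(cvec M e i j \<bullet> g) / (entropy_var P (u j) - entropy_var P (u i)),
              0,
              (cvec M e j i \<bullet> g) / (entropy_var P (u i) - entropy_var P (u j))})"

definition udot :: "('d::finite) mesh \<Rightarrow> 'd law \<Rightarrow> (nat \<Rightarrow> real) \<Rightarrow> nat \<Rightarrow> real" where
  "udot M P u i =
     1 / lumped_mass M i *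
     (\<Sum>e\<in>elems_of_node M i. \<Sum>j\<in>nodes_of_elem M e - {i}.
        d_max M P u e i j * (u j - u i) - cvec M e i j \<bullet> (flux P (u j) - flux P (u i)))"

definition raw_flux ::
  "('d::finite) mesh \<Rightarrow> 'd law \<Rightarrow> (nat \<Rightarrow> real) \<Rightarrow> nat \<Rightarrow> nat \<Rightarrow> nat \<Rightarrow> real" where
  "raw_flux M P u e i j =
     mass M e i j * (udot M P u i - udot M P u j) +
     (d_min M P u e i j - d_max M P u e i j) * (u j - u i) +
     entropy_visc M P u e i j * (entropy_var P (u j) - entropy_var P (u i))"

definition u_min :: "('d::finite) mesh \<Rightarrow> (nat \<Rightarrow> real) \<Rightarrow> nat \<Rightarrow> real" where
  "u_min M u i = Min (u ` neighbours M i)"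

definition u_max :: "('d::finite) mesh \<Rightarrow> (nat \<Rightarrow> real) \<Rightarrow> nat \<Rightarrow> real" where
  "u_max M u i = Max (u ` neighbours M i)"

definition bar_state ::
  "('d::finite) mesh \<Rightarrow> 'd law \<Rightarrow> (nat \<Rightarrow> real) \<Rightarrow> nat \<Rightarrow> nat \<Rightarrow> nat \<Rightarrow> real" where
  "bar_state M P u e i j =
     (u j + u i) / 2 -
     (cvec M e i j \<bullet> (flux P (u j) - flux P (u i))) / (2 * d_max M P u e i j)"

definition bp_flux ::
  "('d::finite) mesh \<Rightarrow> 'd law \<Rightarrow> (nat \<Rightarrow> real) \<Rightarrow> nat \<Rightarrow> nat \<Rightarrow> nat \<Rightarrow> real" where
  "bp_flux M P u e i j =
     (if raw_flux M P u e i j > 0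
      then min (raw_flux M P u e i j)
             (2 * d_max M P u e i j *
              min (u_max M u i - bar_state M P u e i j) (bar_state M P u e j i - u_min M u j))
      else max (raw_flux M P u e i j)
             (2 * d_max M P u e i j *
              max (u_min M u i - bar_state M P u e i j) (bar_state M P u e j i - u_max M u j)))"

definition Q_corr ::
  "('d::finite) mesh \<Rightarrow> 'd law \<Rightarrow> (nat \<Rightarrow> real) \<Rightarrow> nat \<Rightarrow> nat \<Rightarrow> nat \<Rightarrow> real" where
  "Q_corr M P u e i j =
     Q M P u e i j -
     (entropy_var P (u j) - entropy_var P (u i)) * d_max M P u e i j * (u i - u j)"

definition ec_flux ::
  "('d::finite) mesh \<Rightarrow> 'd law \<Rightarrow> (nat \<Rightarrow> real) \<Rightarrow> nat \<Rightarrow> nat \<Rightarrow> nat \<Rightarrow> real" where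
  "ec_flux M P u e i j =
     (let w = entropy_var P (u i) - entropy_var P (u j)
      in if w * bp_flux M P u e i j > 0
         then Min {Q_corr M P u e i j, w * bp_flux M P u e i j, Q_corr M P u e j i} / w
         else bp_flux M P u e i j)"

text \<open>The semi-discrete scheme is \<open>m\<^sub>i du\<^sub>i/dt = scheme_rhs M P u i\<close>.\<close>

definition scheme_rhs :: "('d::finite) mesh \<Rightarrow> 'd law \<Rightarrow> (nat \<Rightarrow> real) \<Rightarrow> nat \<Rightarrow> real" where
  "scheme_rhs M P u i =
     (\<Sum>e\<in>elems_of_node M i. \<Sum>j\<in>nodes_of_elem M e - {i}.
        d_max M P u e i j * (u j - u i) + ec_flux M P u e i j
        - cvec M e i j \<bullet> (flux P (u j) - flux P (u i)))"

definition euler_stage ::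
  "('d::finite) mesh \<Rightarrow> 'd law \<Rightarrow> real \<Rightarrow> (nat \<Rightarrow> real) \<Rightarrow> nat \<Rightarrow> real" where
  "euler_stage M P \<tau> u i = u i + \<tau> / lumped_mass M i * scheme_rhs M P u i"

definition time_step_ok ::
  "('d::finite) mesh \<Rightarrow> 'd law \<Rightarrow> real \<Rightarrow> (nat \<Rightarrow> real) \<Rightarrow> nat \<Rightarrow> bool" where
  "time_step_ok M P \<tau> u i \<longleftrightarrow>
     \<tau> * (\<Sum>e\<in>elems_of_node M i. \<Sum>j\<in>nodes_of_elem M e - {i}. 2 * d_max M P u e i j)
       \<le> lumped_mass M i"


section \<open>Explicit SSP Runge--Kutta methods\<close>

text \<open>Shu--Osher form: every stage is a convex combination, with weights \<open>\<alpha> k l\<close>, of forward Euler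
  updates of earlier stages \<open>l < k\<close> with time steps \<open>(\<beta> k l / \<alpha> k l) * \<Delta>t\<close>.  The stage with
  index 0 is the old solution and the one with index \<open>s\<close> is the new solution.\<close>

definition ssp_coeffs :: "nat \<Rightarrow> (nat \<Rightarrow> nat \<Rightarrow> real) \<Rightarrow> (nat \<Rightarrow> nat \<Rightarrow> real) \<Rightarrow> bool" where
  "ssp_coeffs s \<alpha> \<beta> \<longleftrightarrow>
     (\<forall>k\<in>{1..s}.
        (\<forall>l<k. 0 \<le> \<alpha> k l \<and> 0 \<le> \<beta> k l \<and> (\<alpha> k l = 0 \<longrightarrow> \<beta> k l = 0)) \<and>
        (\<Sum>l<k. \<alpha> k l) = 1)"

definition ssp_rk_stages ::
  "('d::finite) mesh \<Rightarrow> 'd law \<Rightarrow> nat \<Rightarrow> (nat \<Rightarrow> nat \<Rightarrow> real) \<Rightarrow> (nat \<Rightarrow> nat \<Rightarrow> real) \<Rightarrow> real \<Rightarrow>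
   (nat \<Rightarrow> nat \<Rightarrow> real) \<Rightarrow> bool" where
  "ssp_rk_stages M P s \<alpha> \<beta> \<Delta>t U \<longleftrightarrow>
     (\<forall>k\<in>{1..s}. \<forall>i\<in>nodes M.
        U k i = (\<Sum>l<k. \<alpha> k l * euler_stage M P (\<beta> k l / \<alpha> k l * \<Delta>t) (U l) i))"

end

theory Submission imports Defs begin

text \<open>A summand of the scheme has the form \<open>2 d\<^sub>i\<^sub>j (b\<^sub>i\<^sub>j - u\<^sub>i) + f\<^sub>i\<^sub>j\<close> with the bar state
  \<open>b\<^sub>i\<^sub>j\<close> and the limited flux \<open>f\<^sub>i\<^sub>j\<close>.  As \<open>d\<^sub>i\<^sub>j\<close> dominates the wave speed, bar states lie
  between \<open>u\<^sub>i\<close> and \<open>u\<^sub>j\<close>, so the bound-preserving limiter never changes the sign of a flux.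
  Neither does the entropy limiter: since \<open>\<psi>' = v' f\<close> and \<open>v\<close> is nondecreasing, the entropy
  production \<open>Q\<^sub>i\<^sub>j\<close> is at most \<open>d\<^sub>i\<^sub>j (u\<^sub>j - u\<^sub>i) (v\<^sub>j - v\<^sub>i)\<close> in absolute value.  Hence every
  summand lies between \<open>2 d\<^sub>i\<^sub>j (u_min - u\<^sub>i)\<close> and \<open>2 d\<^sub>i\<^sub>j (u_max - u\<^sub>i)\<close>, and under the step
  restriction the total increment lies between \<open>u_min - u\<^sub>i\<close> and \<open>u_max - u\<^sub>i\<close>.  Only the sign of the
  lumped mass matters, and the step restriction itself forces it to be nonnegative.\<close>

section \<open>The entropy variable\<close>

lemma deriv_in_works:
  assumes "g differentiable (at w within G)"
  shows "(g has_vector_derivative deriv_in G g w) (at w within G)"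
  using assms unfolding deriv_in_def by (simp add: vector_derivative_works)

text \<open>Convexity bounds the difference quotients of f along the segment from c towards x by
  \<open>f x - f c\<close>; the limit at c gives the claim. The derivative is taken within G, so end
  points of G are covered.\<close>

lemma convex_on_above_tangent_within:
  fixes f :: "real \<Rightarrow> real"
  assumes f: "convex_on G f" and c: "c \<in> G" and x: "x \<in> G"
    and D: "(f has_vector_derivative D) (at c within G)"
  shows "D * (x - c) \<le> f x - f c"
proof -
  have G: "convex G" using f by (simp add: convex_on_def)
  define l where "l t = c + t * (x - c)" for t
  have l_eq: "l t = (1 - t) *\<^sub>R c + t *\<^sub>R x" for t
    by (simp add: l_def algebra_simps)
  have lG: "l ` {0..1} \<subseteq> G"
    using convexD_alt[OF G c x] by (auto simp: l_eq)
  have dl: "(l has_vector_derivative (x - c)) (at 0 within {0..1})"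
    unfolding l_def has_real_derivative_iff_has_vector_derivative[symmetric]
    by (auto intro!: derivative_eq_intros)
  have "(f has_vector_derivative D) (at (l 0) within l ` {0..1})"
    using D lG by (auto simp: l_def intro: has_vector_derivative_within_subset)
  from vector_diff_chain_within[OF dl this]
  have "((f \<circ> l) has_real_derivative (x - c) * D) (at 0 within {0..1})"
    by (simp add: has_real_derivative_iff_has_vector_derivative)
  then have lim: "((\<lambda>t. ((f \<circ> l) t - (f \<circ> l) 0) / (t - 0)) \<longlongrightarrow> (x - c) * D) (at 0 within {0..1})"
    by (simp add: has_field_derivative_iff)
  have ev: "\<forall>\<^sub>F t in at 0 within {0..1}. ((f \<circ> l) t - (f \<circ> l) 0) / (t - 0) \<le> f x - f c"
  proof -
    have "((f \<circ> l) t - (f \<circ> l) 0) / (t - 0) \<le> f x - f c" if "t \<in> {0<..1}" for t :: real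
    proof -
      have "f (l t) \<le> (1 - t) * f c + t * f x"
        using convex_onD[OF f, of t c x] that c x by (simp add: l_eq)
      then have "f (l t) - f c \<le> (f x - f c) * t" by (simp add: algebra_simps)
      then show ?thesis using that by (simp add: l_def pos_divide_le_eq)
    qed
    then show ?thesis by (auto simp: eventually_at_filter intro!: always_eventually)
  qed
  have "(x - c) * D \<le> f x - f c"
    by (rule tendsto_upperbound[OF lim ev]) (simp add: trivial_limit_within islimpt_Icc)
  then show ?thesis by (simp add: mult.commute)
qed

text \<open>The tangent inequalities at r and s enclose the entropy difference between
  \<open>entropy_var P r * (s - r)\<close> and \<open>entropy_var P s * (s - r)\<close>.\<close>

lemma mono_on_entropy_var:
  assumes P: "conservation_law P"
  shows "mono_on (states P) (entropy_var P)"
proof (rule mono_onI)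
  fix r s assume r: "r \<in> states P" and s: "s \<in> states P" and "r \<le> s"
  have D: "(entropy P has_vector_derivative entropy_var P w) (at w within states P)"
    if "w \<in> states P" for w
    using P that deriv_in_works unfolding conservation_law_def C1_in_def entropy_var_def by blast
  have cv: "convex_on (states P) (entropy P)" using P by (simp add: conservation_law_def)
  have "entropy_var P r * (s - r) \<le> entropy_var P s * (s - r)"
    using convex_on_above_tangent_within[OF cv r s D[OF r]]
      convex_on_above_tangent_within[OF cv s r D[OF s]] by (simp add: algebra_simps)
  then show "entropy_var P r \<le> entropy_var P s"
    using \<open>r \<le> s\<close> by (cases "r = s") auto
qed

section \<open>Bounds by the maximal wave speed\<close>

text \<open>Mean value theorem. Derivatives are asked for in the open interval only, where
  derivatives within the state interval are two-sided.\<close>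

lemma abs_diff_le_DERIV_bound:
  fixes h :: "real \<Rightarrow> real"
  assumes ab: "a \<le> b"
    and h: "continuous_on {a..b} h" "\<And>w. a < w \<Longrightarrow> w < b \<Longrightarrow> (h has_real_derivative h' w) (at w)"
    and L: "\<And>w. a < w \<Longrightarrow> w < b \<Longrightarrow> \<bar>h' w\<bar> \<le> L"
  shows "\<bar>h b - h a\<bar> \<le> L * (b - a)"
proof (cases "a = b")
  case False
  then have "a < b" using ab by simp
  moreover have "h differentiable (at w)" if "a < w" "w < b" for w
    using h(2)[OF that] by (auto simp: real_differentiable_def)
  ultimately obtain l z where z: "a < z" "z < b" "(h has_real_derivative l) (at z)"
    and eq: "h b - h a = (b - a) * l"
    using MVT[OF _ h(1)] by blast
  have "l = h' z" using z h(2) DERIV_unique by blast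
  then have "\<bar>l\<bar> \<le> L" using L z by simp
  then have "(b - a) * \<bar>l\<bar> \<le> (b - a) * L" using ab by (intro mult_left_mono) auto
  then show ?thesis using ab by (simp add: eq abs_mult mult.commute)
qed simp

lemma at_within_convex_open_segment:
  fixes G :: "real set"
  assumes "convex G" "a \<in> G" "b \<in> G" "a < w" "w < b"
  shows "at w within G = at w"
proof (rule at_within_interior)
  have "{a<..<b} \<subseteq> G"
    using closed_segment_subset[OF assms(2,3,1)] assms(4,5)
    by (auto simp: closed_segment_eq_real_ivl)
  then show "w \<in> interior G" using assms(4,5) by (intro interiorI[of "{a<..<b}"]) auto
qed

section \<open>Derivatives of flux, entropy variable and entropy potential\<close>

lemma flux_has_vector_derivative:
  assumes "conservation_law P" "w \<in> states P"
  shows "(flux P has_vector_derivative flux_deriv P w) (at w within states P)"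
  using assms deriv_in_works unfolding conservation_law_def C1_in_def flux_deriv_def by blast

lemma entropy_var_has_vector_derivative:
  assumes "conservation_law P" "w \<in> states P"
  shows "(entropy_var P has_vector_derivative deriv_in (states P) (entropy_var P) w)
    (at w within states P)"
  using assms deriv_in_works unfolding conservation_law_def C1_in_def by blast

text \<open>By the product rule, the derivative of v f - q is v' f + v f' - q', and the
  compatibility q' = v f' of the entropy pair leaves v' f.\<close>

lemma entropy_potential_has_vector_derivative:
  assumes P: "conservation_law P" and w: "w \<in> states P"
  shows "(entropy_potential P has_vector_derivative
    (deriv_in (states P) (entropy_var P) w *\<^sub>R flux P w)) (at w within states P)"
proof -
  have q: "(entropy_flux P has_vector_derivative (entropy_var P w *\<^sub>R flux_deriv P w))
      (at w within states P)"
    using P w by (simp add: conservation_law_def)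
  have v: "(entropy_var P has_field_derivative deriv_in (states P) (entropy_var P) w)
      (at w within states P)"
    using entropy_var_has_vector_derivative[OF P w]
    by (simp add: has_real_derivative_iff_has_vector_derivative)
  show ?thesis
    using has_vector_derivative_diff[OF has_vector_derivative_scaleR[OF v flux_has_vector_derivative[OF P w]] q]
    by (simp add: entropy_potential_def[abs_def])
qed

lemma has_real_derivative_inner_right:
  fixes g :: "real \<Rightarrow> 'a::real_inner"
  assumes "(g has_vector_derivative D) F"
  shows "((\<lambda>w. c \<bullet> g w) has_real_derivative c \<bullet> D) F"
  using bounded_linear.has_vector_derivative[OF bounded_linear_inner_right assms, of c]
  by (simp add: has_real_derivative_iff_has_vector_derivative)

lemma flux_diff_le_ordered:
  assumes P: "conservation_law P" and a: "a \<in> states P" and b: "b \<in> states P" and ab: "a \<le> b"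
    and L: "\<And>w. w \<in> {a..b} \<Longrightarrow> \<bar>c \<bullet> flux_deriv P w\<bar> \<le> L"
  shows "\<bar>c \<bullet> (flux P b - flux P a)\<bar> \<le> L * (b - a)"
proof -
  have cv: "convex (states P)" using P by (simp add: conservation_law_def)
  have sub: "{a..b} \<subseteq> states P"
    using closed_segment_subset[OF a b cv] ab by (simp add: closed_segment_eq_real_ivl)
  have D: "((\<lambda>w. c \<bullet> flux P w) has_real_derivative c \<bullet> flux_deriv P w) (at w within states P)"
    if "w \<in> states P" for w
    using has_real_derivative_inner_right[OF flux_has_vector_derivative[OF P that]] .
  have "continuous_on {a..b} (\<lambda>w. c \<bullet> flux P w)"
    using continuous_on_subset[OF DERIV_continuous_on[OF D] sub] .
  moreover have "((\<lambda>w. c \<bullet> flux P w) has_real_derivative c \<bullet> flux_deriv P w) (at w)"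
    if w: "a < w" "w < b" for w
  proof -
    have "w \<in> states P" using sub w by auto
    from D[OF this] show ?thesis unfolding at_within_convex_open_segment[OF cv a b w] .
  qed
  ultimately have "\<bar>c \<bullet> flux P b - c \<bullet> flux P a\<bar> \<le> L * (b - a)"
    using L by (intro abs_diff_le_DERIV_bound[where h' = "\<lambda>w. c \<bullet> flux_deriv P w"] ab) auto
  then show ?thesis by (simp add: inner_diff_right)
qed

lemma flux_diff_le:
  assumes "conservation_law P" "a \<in> states P" "b \<in> states P"
    and "\<And>w. w \<in> closed_segment a b \<Longrightarrow> \<bar>c \<bullet> flux_deriv P w\<bar> \<le> L"
  shows "\<bar>c \<bullet> (flux P b - flux P a)\<bar> \<le> L * \<bar>b - a\<bar>"
  using flux_diff_le_ordered[of P a b c L] flux_diff_le_ordered[of P b a c L] assms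
  by (cases "a \<le> b") (auto simp: closed_segment_eq_real_ivl inner_diff_right abs_minus_commute)

section \<open>Entropy production between two states\<close>

text \<open>This is \<open>Q\<close> with the vector and the two states as free parameters, so that
  the states can be swapped while c stays fixed.\<close>

definition entropy_production :: "('d::finite) law \<Rightarrow> real^'d \<Rightarrow> real \<Rightarrow> real \<Rightarrow> real" where
  "entropy_production P c a b =
     2 * (c \<bullet> (entropy_potential P b - entropy_potential P a +
       (entropy_var P a - entropy_var P b) *\<^sub>R ((flux P b + flux P a) /\<^sub>R 2)))"

text \<open>The production is twice the integral of v' (c . f - m) over [a, b], where m is the mean
  of c . f at the end points. There c . f differs from m by at most L (b - a) / 2, and v' is
  nonnegative. Monotonicity of auxiliary functions takes the place of the integral.\<close>

lemma entropy_production_le_ordered: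
  assumes P: "conservation_law P" and a: "a \<in> states P" and b: "b \<in> states P" and ab: "a \<le> b"
    and L: "\<And>w. w \<in> {a..b} \<Longrightarrow> \<bar>c \<bullet> flux_deriv P w\<bar> \<le> L"
  shows "\<bar>entropy_production P c a b\<bar> \<le> L * (b - a) * (entropy_var P b - entropy_var P a)"
proof -
  have cv: "convex (states P)" using P by (simp add: conservation_law_def)
  have sub: "{a..b} \<subseteq> states P"
    using closed_segment_subset[OF a b cv] ab by (simp add: closed_segment_eq_real_ivl)
  let ?G = "states P" and ?v = "entropy_var P"
  let ?v' = "deriv_in ?G ?v"
  define m where "m = c \<bullet> ((flux P b + flux P a) /\<^sub>R 2)"
  define K where "K = L * (b - a) / 2"
  \<comment> \<open>A primitive of v' (c . f - m), so that the production equals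
    \<open>2 * (p b - p a)\<close>.\<close>
  define p where "p w = c \<bullet> entropy_potential P w - ?v w * m" for w
  have Dv: "(?v has_real_derivative ?v' w) (at w within ?G)" if "w \<in> ?G" for w
    using entropy_var_has_vector_derivative[OF P that]
    by (simp add: has_real_derivative_iff_has_vector_derivative)
  have Dp: "(p has_real_derivative ?v' w * (c \<bullet> flux P w - m)) (at w within ?G)"
    if w: "w \<in> ?G" for w
    using DERIV_diff[OF has_real_derivative_inner_right[OF entropy_potential_has_vector_derivative[OF P w], of c]
        DERIV_cmult_right[OF Dv[OF w], of m]]
    by (simp add: p_def[abs_def] algebra_simps)
  have "continuous_on {a..b} ?v" "continuous_on {a..b} p"
    using DERIV_continuous_on[OF Dv] DERIV_continuous_on[OF Dp] sub
    by (auto intro: continuous_on_subset)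
  then have cont: "continuous_on {a..b} (\<lambda>w. K * ?v w + s * p w)" for s
    by (intro continuous_intros)
  have mean: "\<bar>c \<bullet> flux P w - m\<bar> \<le> K" if w: "a < w" "w < b" for w
  proof -
    \<comment> \<open>Twice the deviation from m is the increment of c . f over [a, w] minus that
      over [w, b]. The bounds of the two increments add up to L (b - a) for every w.\<close>
    have half: "\<bar>(x - y) / 2\<bar> \<le> K" if "\<bar>x\<bar> \<le> X" "\<bar>y\<bar> \<le> Y" "X + Y = 2 * K" for x y X Y
      using that by (simp add: abs_le_iff)
    have "\<bar>c \<bullet> (flux P w - flux P a)\<bar> \<le> L * (w - a)" "\<bar>c \<bullet> (flux P b - flux P w)\<bar> \<le> L * (b - w)"
      using w sub by (auto intro!: flux_diff_le_ordered P L)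
    moreover have "c \<bullet> flux P w - m =
        (c \<bullet> (flux P w - flux P a) - c \<bullet> (flux P b - flux P w)) / 2"
      by (simp add: m_def inner_diff_right inner_add_right field_simps)
    moreover have "L * (w - a) + L * (b - w) = 2 * K" by (simp add: K_def algebra_simps)
    ultimately show ?thesis using half by metis
  qed
  \<comment> \<open>The derivative is v' (K + s (c . f - m)), nonnegative by \<open>mean\<close>.
    The signs s = 1 and s = -1 give the two halves of the bound on
    \<open>\<bar>p b - p a\<bar>\<close>.\<close>
  have mono: "K * ?v a + s * p a \<le> K * ?v b + s * p b" if s: "\<bar>s\<bar> = 1" for s
  proof (rule DERIV_nonneg_imp_increasing_open[OF ab _ cont])
    fix w assume w: "a < w" "w < b"
    have wG: "w \<in> ?G" using sub w by auto
    note at = at_within_convex_open_segment[OF cv a b w]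
    have "{a<..<b} \<subseteq> ?G" using sub by auto
    then have "w \<in> interior ?G" using w by (intro interiorI[of "{a<..<b}"]) auto
    then have v': "?v' w \<ge> 0"
      using mono_on_imp_deriv_nonneg[OF mono_on_entropy_var[OF P]] Dv[OF wG] at by simp
    have "((\<lambda>w. K * ?v w + s * p w) has_real_derivative
        K * ?v' w + s * (?v' w * (c \<bullet> flux P w - m))) (at w)"
      using Dv[OF wG] Dp[OF wG] unfolding at by (auto intro!: derivative_eq_intros)
    moreover have "\<bar>s * (c \<bullet> flux P w - m)\<bar> \<le> K"
      using mean[OF w] s by (simp add: abs_mult)
    then have "0 \<le> ?v' w * (K + s * (c \<bullet> flux P w - m))"
      using v' by (intro mult_nonneg_nonneg) auto
    then have "0 \<le> K * ?v' w + s * (?v' w * (c \<bullet> flux P w - m))"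
      by (simp add: algebra_simps)
    ultimately show "\<exists>y. ((\<lambda>w. K * ?v w + s * p w) has_real_derivative y) (at w) \<and> 0 \<le> y"
      by blast
  qed
  have "entropy_production P c a b = 2 * (p b - p a)"
    by (simp add: entropy_production_def p_def m_def inner_diff_right inner_add_right algebra_simps)
  then have "\<bar>entropy_production P c a b\<bar> = 2 * \<bar>p b - p a\<bar>"
    by (simp only: abs_mult abs_numeral)
  moreover have "\<bar>p b - p a\<bar> \<le> K * (?v b - ?v a)"
    using mono[of 1] mono[of "-1"] by (simp add: algebra_simps abs_le_iff)
  ultimately show ?thesis by (simp add: K_def)
qed

text \<open>Swapping a and b with c fixed flips the sign of the production and keeps the product on
  the right unchanged.\<close>

lemma entropy_production_le:
  assumes P: "conservation_law P" "a \<in> states P" "b \<in> states P"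
    and L: "\<And>w. w \<in> closed_segment a b \<Longrightarrow> \<bar>c \<bullet> flux_deriv P w\<bar> \<le> L"
  shows "\<bar>entropy_production P c a b\<bar> \<le> L * ((b - a) * (entropy_var P b - entropy_var P a))"
proof (cases "a \<le> b")
  case True
  then show ?thesis
    using entropy_production_le_ordered[OF P True, of c L] L
    by (simp add: closed_segment_eq_real_ivl mult.assoc)
next
  case False
  then have "b \<le> a" by simp
  have "entropy_production P c a b = - entropy_production P c b a"
    by (simp add: entropy_production_def inner_diff_right inner_add_right algebra_simps)
  then show ?thesis
    using entropy_production_le_ordered[OF P(1,3,2) \<open>b \<le> a\<close>, of c L] L False
    by (simp add: closed_segment_eq_real_ivl algebra_simps)
qed

section \<open>Bar states and limited fluxes\<close>

text \<open>A real supremum is an upper bound only of a set that is bounded above; here boundedness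
  comes from continuity of the flux derivative on a compact segment.\<close>

lemma lambda_max_ge:
  assumes P: "conservation_law P" and u: "u i \<in> states P" "u j \<in> states P"
    and w: "w \<in> closed_segment (u i) (u j)"
  shows "\<bar>nvec M e i j \<bullet> flux_deriv P w\<bar> \<le> lambda_max M P u e i j"
proof -
  define l where "l \<omega> = \<omega> * u i + (1 - \<omega>) * u j" for \<omega>
  have cv: "convex (states P)" using P by (simp add: conservation_law_def)
  have lG: "l ` {0..1} \<subseteq> states P"
    using convexD_alt[OF cv u(2,1)] by (auto simp: l_def algebra_simps)
  have "continuous_on (states P) (flux_deriv P)"
    using P by (simp add: conservation_law_def C1_in_def flux_deriv_def)
  then have "continuous_on (l ` {0..1}) (flux_deriv P)" by (rule continuous_on_subset) fact
  then have "continuous_on {0..1} (\<lambda>\<omega>. flux_deriv P (l \<omega>))"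
    by (rule continuous_on_compose2) (auto simp: l_def intro!: continuous_intros)
  then have "continuous_on {0..1} (\<lambda>\<omega>. \<bar>nvec M e i j \<bullet> flux_deriv P (l \<omega>)\<bar>)"
    by (intro continuous_intros)
  then have bdd: "bdd_above ((\<lambda>\<omega>. \<bar>nvec M e i j \<bullet> flux_deriv P (l \<omega>)\<bar>) ` {0..1})"
    by (intro bounded_imp_bdd_above compact_imp_bounded compact_continuous_image) auto
  obtain t where t: "0 \<le> t" "t \<le> 1" "w = (1 - t) *\<^sub>R u i + t *\<^sub>R u j"
    using w by (auto simp: in_segment)
  \<comment> \<open>The weight \<omega> belongs to \<open>u i\<close>, whereas the segment parameter
    t belongs to \<open>u j\<close>.\<close>
  then have "w = l (1 - t)" by (simp add: l_def)
  moreover have "1 - t \<in> {0..1}" using t by auto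
  ultimately show ?thesis
    unfolding lambda_max_def l_def[symmetric] using cSUP_upper[OF _ bdd] by metis
qed

lemma d_max_ge:
  assumes P: "conservation_law P" and u: "u i \<in> states P" "u j \<in> states P"
    and w: "w \<in> closed_segment (u i) (u j)"
  shows "\<bar>cvec M e i j \<bullet> flux_deriv P w\<bar> \<le> d_max M P u e i j"
proof -
  \<comment> \<open>This covers the zero vector too, whose normalization is zero.\<close>
  have "cvec M e i j = norm (cvec M e i j) *\<^sub>R nvec M e i j"
    by (cases "cvec M e i j = 0") (simp_all add: nvec_def)
  then have "\<bar>cvec M e i j \<bullet> flux_deriv P w\<bar> =
      norm (cvec M e i j) * \<bar>nvec M e i j \<bullet> flux_deriv P w\<bar>"
    by (metis abs_mult abs_norm_cancel inner_scaleR_left)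
  also have "\<dots> \<le> d_max M P u e i j"
    unfolding d_max_def
    using lambda_max_ge[OF assms, of M e] by (intro mult_mono) (auto simp: le_max_iff_disj)
  finally show ?thesis .
qed

text \<open>The coefficient dominates an absolute value, for instance the one at the state
  \<open>u i\<close>.\<close>

lemma d_max_nonneg:
  assumes "conservation_law P" "u i \<in> states P" "u j \<in> states P"
  shows "0 \<le> d_max M P u e i j"
  using d_max_ge[OF assms ends_in_segment(1), of M e] by linarith

text \<open>\<open>Q_corr\<close> is \<open>Q\<close> plus d (u_j - u_i) (v_j - v_i), which is
  exactly the bound on the absolute value of \<open>Q\<close>.\<close>

lemma Q_corr_nonneg:
  assumes "conservation_law P" "u i \<in> states P" "u j \<in> states P"
  shows "0 \<le> Q_corr M P u e i j"
proof -
  have "Q M P u e i j = entropy_production P (cvec M e i j) (u i) (u j)"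
    by (simp add: Q_def entropy_production_def)
  then show ?thesis
    using entropy_production_le[OF assms d_max_ge[OF assms], of M e]
    by (simp add: Q_corr_def algebra_simps abs_le_iff)
qed

lemma flux_diff_le_d_max:
  assumes "conservation_law P" "u i \<in> states P" "u j \<in> states P"
  shows "\<bar>cvec M e i j \<bullet> (flux P (u j) - flux P (u i))\<bar> \<le> d_max M P u e i j * \<bar>u j - u i\<bar>"
  by (rule flux_diff_le[OF assms d_max_ge[OF assms]])

text \<open>The bar state deviates from the midpoint of \<open>u i\<close> and \<open>u j\<close> by
  at most half their distance; for \<open>d_max = 0\<close> it is the midpoint.\<close>

lemma bar_state_between:
  assumes "conservation_law P" "u i \<in> states P" "u j \<in> states P"
  shows "bar_state M P u e i j \<in> closed_segment (u i) (u j)"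
proof -
  let ?x = "cvec M e i j \<bullet> (flux P (u j) - flux P (u i))" and ?d = "d_max M P u e i j"
  have "\<bar>?x / (2 * ?d)\<bar> \<le> \<bar>u j - u i\<bar> / 2"
    using flux_diff_le_d_max[OF assms, of M e] d_max_nonneg[OF assms, of M e]
    by (cases "?d = 0") (auto simp: field_simps abs_mult)
  then have "\<bar>bar_state M P u e i j - (u j + u i) / 2\<bar> \<le> \<bar>u j - u i\<bar> / 2"
    by (simp add: bar_state_def)
  then show ?thesis
    unfolding closed_segment_eq_real_ivl abs_le_iff by (cases "u i \<le> u j") (simp_all add: field_simps)
qed

text \<open>For \<open>d_max = 0\<close> the division in the bar state is by zero, but then the flux difference
  vanishes as well.\<close>

lemma low_order_flux_eq_bar_state:
  assumes "conservation_law P" "u i \<in> states P" "u j \<in> states P"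
  shows "d_max M P u e i j * (u j - u i) - cvec M e i j \<bullet> (flux P (u j) - flux P (u i)) =
    2 * d_max M P u e i j * (bar_state M P u e i j - u i)"
  using flux_diff_le_d_max[OF assms, of M e]
  by (cases "d_max M P u e i j = 0") (auto simp: bar_state_def field_simps)

text \<open>The limiting factors for positive fluxes are nonnegative and those for the others
  nonpositive, so limiting keeps the sign. One of the two bounds is then enforced by the limiter,
  the other holds by sign.\<close>

lemma bp_flux_bounds:
  assumes d: "0 \<le> d_max M P u e i j"
    and i: "u_min M u i \<le> bar_state M P u e i j" "bar_state M P u e i j \<le> u_max M u i"
    and j: "u_min M u j \<le> bar_state M P u e j i" "bar_state M P u e j i \<le> u_max M u j"
  shows "2 * d_max M P u e i j * (u_min M u i - bar_state M P u e i j) \<le> bp_flux M P u e i j"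
    and "bp_flux M P u e i j \<le> 2 * d_max M P u e i j * (u_max M u i - bar_state M P u e i j)"
proof -
  let ?d = "2 * d_max M P u e i j" and ?f = "raw_flux M P u e i j"
  define X where "X = u_max M u i - bar_state M P u e i j"
  define X' where "X' = u_min M u i - bar_state M P u e i j"
  define Y where "Y = bar_state M P u e j i - u_min M u j"
  define Y' where "Y' = bar_state M P u e j i - u_max M u j"
  have sgn: "0 \<le> X" "0 \<le> Y" "X' \<le> 0" "Y' \<le> 0" using i j by (auto simp: X_def X'_def Y_def Y'_def)
  have bp: "bp_flux M P u e i j =
      (if ?f > 0 then min ?f (?d * min X Y) else max ?f (?d * max X' Y'))"
    by (simp add: bp_flux_def X_def X'_def Y_def Y'_def)
  have "?d * X' \<le> bp_flux M P u e i j \<and> bp_flux M P u e i j \<le> ?d * X"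
  proof -
    have "0 \<le> ?d * min X Y" "?d * max X' Y' \<le> 0" "?d * X' \<le> 0" "0 \<le> ?d * X"
      using d sgn by (intro mult_nonneg_nonneg mult_nonneg_nonpos; simp)+
    moreover have "?d * min X Y \<le> ?d * X" "?d * X' \<le> ?d * max X' Y'"
      using d by (auto intro!: mult_left_mono)
    ultimately show ?thesis unfolding bp by (smt (verit))
  qed
  then show "?d * (u_min M u i - bar_state M P u e i j) \<le> bp_flux M P u e i j"
    and "bp_flux M P u e i j \<le> ?d * (u_max M u i - bar_state M P u e i j)"
    by (simp_all add: X_def X'_def)
qed

lemma ec_flux_between:
  assumes "0 \<le> Q_corr M P u e i j" "0 \<le> Q_corr M P u e j i"
  shows "ec_flux M P u e i j \<in> closed_segment 0 (bp_flux M P u e i j)"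
proof -
  define w where "w = entropy_var P (u i) - entropy_var P (u j)"
  define f where "f = bp_flux M P u e i j"
  define q where "q = Min {Q_corr M P u e i j, w * f, Q_corr M P u e j i}"
  have ec: "ec_flux M P u e i j = (if w * f > 0 then q / w else f)"
    by (simp add: ec_flux_def w_def f_def q_def Let_def)
  show ?thesis
  proof (cases "w * f > 0")
    case True
    then have "0 \<le> q" "q \<le> w * f" using assms by (auto simp: q_def)
    \<comment> \<open>Division by w maps the interval between 0 and w f to the one between 0 and f,
      in reversed order when w is negative.\<close>
    from True consider "0 < w" "0 < f" | "w < 0" "f < 0"
      by (auto simp: zero_less_mult_iff)
    then have "q / w \<in> closed_segment 0 f"
      by cases (use \<open>0 \<le> q\<close> \<open>q \<le> w * f\<close> in \<open>simp_all add: closed_segment_eq_real_ivl field_simps\<close>)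
    then show ?thesis using True ec by (simp add: f_def)
  next
    case False
    then show ?thesis using ec by (simp add: f_def)
  qed
qed

section \<open>The local maximum principle\<close>

text \<open>A node is the image of an extreme point of a reference element, hence lies in that
  element with lattice shift 0.\<close>

lemma elem_of_node_ex:
  assumes "fe_mesh M" "i \<in> nodes M"
  shows "elems_of_node M i \<noteq> {}"
proof -
  obtain e where e: "e \<in> elems M" "node M i \<in> elem_vertices M e"
    using assms unfolding fe_mesh_def nodes_are_vertices_def by blast
  have "node M i \<in> elem M e"
    using e by (auto simp: elem_vertices_def elem_def extreme_point_of_def)
  moreover have "0 \<in> lattice M"
    unfolding lattice_def by (intro CollectI exI[of _ "\<lambda>_. 0"]) simp
  ultimately show ?thesis using e(1) unfolding elems_of_node_def by force
qed

lemma finite_neighbours: "finite (neighbours M i)"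
  by (rule finite_subset[of _ "nodes M"])
    (auto simp: neighbours_def nodes_of_elem_def nodes_def)

lemma node_in_elem_iff:
  assumes "e \<in> elems M" "i \<in> nodes M"
  shows "e \<in> elems_of_node M i \<longleftrightarrow> i \<in> nodes_of_elem M e"
  using assms by (auto simp: elems_of_node_def nodes_of_elem_def)

lemma u_bounds:
  assumes "j \<in> neighbours M i"
  shows "u_min M u i \<le> u j" "u j \<le> u_max M u i"
  using assms finite_neighbours[of M i] by (auto simp: u_min_def u_max_def)

text \<open>This places \<open>u i\<close> between the local bounds and ensures that
  \<open>Min\<close> and \<open>Max\<close> are taken over nonempty sets.\<close>

lemma self_neighbour:
  assumes "fe_mesh M" "i \<in> nodes M"
  shows "i \<in> neighbours M i"
  using elem_of_node_ex[OF assms] node_in_elem_iff assms(2)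
  unfolding neighbours_def elems_of_node_def by fastforce

lemma scheme_summand_bounds:
  fixes P :: "('d::finite) law"
  assumes P: "conservation_law P" and u: "\<forall>i\<in>nodes M. u i \<in> states P"
    and i: "i \<in> nodes M" and e: "e \<in> elems_of_node M i" and j: "j \<in> nodes_of_elem M e"
  defines "r \<equiv> d_max M P u e i j * (u j - u i) + ec_flux M P u e i j
    - cvec M e i j \<bullet> (flux P (u j) - flux P (u i))"
  shows "2 * d_max M P u e i j * (u_min M u i - u i) \<le> r"
    and "r \<le> 2 * d_max M P u e i j * (u_max M u i - u i)"
proof -
  have jn: "j \<in> nodes M" and eM: "e \<in> elems M"
    using j e by (auto simp: nodes_of_elem_def elems_of_node_def)
  have uij: "u i \<in> states P" "u j \<in> states P" using u i jn by auto
  have ie: "i \<in> nodes_of_elem M e" and ej: "e \<in> elems_of_node M j"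
    using node_in_elem_iff[OF eM] i jn e j by auto
  have nb: "i \<in> neighbours M i" "j \<in> neighbours M i" "i \<in> neighbours M j" "j \<in> neighbours M j"
    using e ej ie j by (auto simp: neighbours_def)
  note bd = nb[THEN u_bounds(1), of u] nb[THEN u_bounds(2), of u]
  have bi: "u_min M u i \<le> bar_state M P u e i j \<and> bar_state M P u e i j \<le> u_max M u i"
    using bar_state_between[OF P uij, of M e] bd
    by (auto simp: closed_segment_eq_real_ivl split: if_splits)
  have bj: "u_min M u j \<le> bar_state M P u e j i \<and> bar_state M P u e j i \<le> u_max M u j"
    using bar_state_between[OF P uij(2,1), of M e] bd
    by (auto simp: closed_segment_eq_real_ivl split: if_splits)
  have d: "0 \<le> d_max M P u e i j" by (rule d_max_nonneg[OF P uij])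
  note bp = bp_flux_bounds[OF d bi[THEN conjunct1] bi[THEN conjunct2] bj[THEN conjunct1] bj[THEN conjunct2]]
  \<comment> \<open>The entropy-corrected flux lies between 0 and the bound-preserving flux, so both
    bounds must also hold for 0.\<close>
  have s: "2 * d_max M P u e i j * (u_min M u i - bar_state M P u e i j) \<le> 0"
    "0 \<le> 2 * d_max M P u e i j * (u_max M u i - bar_state M P u e i j)"
    using d bi by (intro mult_nonneg_nonneg mult_nonneg_nonpos; simp)+
  have ec: "2 * d_max M P u e i j * (u_min M u i - bar_state M P u e i j) \<le> ec_flux M P u e i j"
    "ec_flux M P u e i j \<le> 2 * d_max M P u e i j * (u_max M u i - bar_state M P u e i j)"
    using ec_flux_between[OF Q_corr_nonneg[OF P uij] Q_corr_nonneg[OF P uij(2,1)], of M e] bp s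
    unfolding closed_segment_eq_real_ivl by (simp_all split: if_splits)
  have r: "r = 2 * d_max M P u e i j * (bar_state M P u e i j - u i) + ec_flux M P u e i j"
    using low_order_flux_eq_bar_state[OF P uij, of M e] by (simp add: r_def)
  show "2 * d_max M P u e i j * (u_min M u i - u i) \<le> r"
    and "r \<le> 2 * d_max M P u e i j * (u_max M u i - u i)"
    \<comment> \<open>The bar state cancels between the low-order part and the flux bounds.\<close>
    using ec unfolding r by (simp_all add: algebra_simps)
qed

lemma euler_stage_bounds:
  fixes P :: "('d::finite) law"
  assumes M: "fe_mesh M" and P: "conservation_law P" and u: "\<forall>i\<in>nodes M. u i \<in> states P"
    and \<tau>: "\<tau> > 0" and i: "i \<in> nodes M" and step: "time_step_ok M P \<tau> u i"
  shows "u_min M u i \<le> euler_stage M P \<tau> u i" and "euler_stage M P \<tau> u i \<le> u_max M u i"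
proof -
  define D where "D = (\<Sum>e\<in>elems_of_node M i. \<Sum>j\<in>nodes_of_elem M e - {i}. 2 * d_max M P u e i j)"
  have bd: "u_min M u i \<le> u i" "u i \<le> u_max M u i"
    using u_bounds[OF self_neighbour[OF M i]] by auto
  have "0 \<le> D"
    unfolding D_def using u i
    by (intro sum_nonneg mult_nonneg_nonneg d_max_nonneg P) (auto simp: nodes_of_elem_def)
  have m: "\<tau> * D \<le> lumped_mass M i" using step by (simp add: time_step_ok_def D_def)
  have m0: "0 \<le> lumped_mass M i"
    using m \<open>0 \<le> D\<close> \<tau> by (meson mult_nonneg_nonneg less_imp_le order_trans)
  define \<theta> where "\<theta> = \<tau> * D / lumped_mass M i"
  \<comment> \<open>A vanishing lumped mass is harmless here: the quotient is then 0.\<close>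
  have \<theta>: "0 \<le> \<theta>" "\<theta> \<le> 1"
    using m m0 \<tau> \<open>0 \<le> D\<close> by (auto simp: \<theta>_def divide_le_eq_1)
  have S: "D * (u_min M u i - u i) \<le> scheme_rhs M P u i"
    "scheme_rhs M P u i \<le> D * (u_max M u i - u i)"
    unfolding D_def scheme_rhs_def sum_distrib_right
    by (intro sum_mono scheme_summand_bounds P u i; simp)+
  have "\<tau> / lumped_mass M i * (D * (u_min M u i - u i)) \<le> \<tau> / lumped_mass M i * scheme_rhs M P u i"
    "\<tau> / lumped_mass M i * scheme_rhs M P u i \<le> \<tau> / lumped_mass M i * (D * (u_max M u i - u i))"
    using S \<tau> m0 by (intro mult_left_mono divide_nonneg_nonneg; simp)+
  then have "\<theta> * (u_min M u i - u i) \<le> euler_stage M P \<tau> u i - u i"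
    "euler_stage M P \<tau> u i - u i \<le> \<theta> * (u_max M u i - u i)"
    by (simp_all add: euler_stage_def \<theta>_def)
  \<comment> \<open>Since \<open>u i\<close> lies between its local bounds, raising the factor from
    \<theta> to 1 only widens the range.\<close>
  moreover have "1 * (u_min M u i - u i) \<le> \<theta> * (u_min M u i - u i)"
    "\<theta> * (u_max M u i - u i) \<le> 1 * (u_max M u i - u i)"
    using \<theta> bd by (intro mult_right_mono mult_right_mono_neg; simp)+
  ultimately show "u_min M u i \<le> euler_stage M P \<tau> u i" and "euler_stage M P \<tau> u i \<le> u_max M u i"
    by simp_all
qed

section \<open>Invariance of the state interval under SSP stages\<close>

lemma u_bounds_in_states:
  assumes "fe_mesh M" "\<forall>i\<in>nodes M. u i \<in> states P" "i \<in> nodes M"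
  shows "u_min M u i \<in> states P" "u_max M u i \<in> states P"
proof -
  have "u ` neighbours M i \<noteq> {}" "finite (u ` neighbours M i)"
    using self_neighbour[OF assms(1,3)] finite_neighbours[of M i] by auto
  moreover have "u ` neighbours M i \<subseteq> states P"
    using assms(2) by (auto simp: neighbours_def nodes_of_elem_def)
  ultimately show "u_min M u i \<in> states P" "u_max M u i \<in> states P"
    unfolding u_min_def u_max_def using Min_in Max_in by blast+
qed

lemma euler_stage_in_states:
  assumes M: "fe_mesh M" and P: "conservation_law P" and u: "\<forall>i\<in>nodes M. u i \<in> states P"
    and i: "i \<in> nodes M" and \<tau>: "\<tau> = 0 \<or> \<tau> > 0 \<and> time_step_ok M P \<tau> u i"
  shows "euler_stage M P \<tau> u i \<in> states P"
proof (cases "\<tau> = 0")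
  case True
  then show ?thesis using u i by (simp add: euler_stage_def)
next
  case False
  then have \<tau>: "\<tau> > 0" "time_step_ok M P \<tau> u i" using \<tau> by auto
  have "convex (states P)" using P by (simp add: conservation_law_def)
  from closed_segment_subset[OF u_bounds_in_states[OF M u i] this]
  show ?thesis using euler_stage_bounds[OF M P u \<tau>(1) i \<tau>(2)]
    by (auto simp: closed_segment_eq_real_ivl split: if_splits)
qed

text \<open>The maximum principle applies to a stage only if its input values are states. Strong
  induction supplies this, each stage being a convex combination of Euler updates of earlier
  ones.\<close>

lemma ssp_rk_stages_in_states:
  assumes M: "fe_mesh M" and P: "conservation_law P"
    and ssp: "ssp_coeffs s \<alpha> \<beta>" and rk: "ssp_rk_stages M P s \<alpha> \<beta> \<Delta>t U" and \<Delta>t: "\<Delta>t > 0"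
    and U0: "\<forall>i\<in>nodes M. U 0 i \<in> states P"
    and step: "\<forall>k\<in>{1..s}. \<forall>l<k. \<beta> k l > 0 \<longrightarrow>
      (\<forall>i\<in>nodes M. time_step_ok M P (\<beta> k l / \<alpha> k l * \<Delta>t) (U l) i)"
    and k: "k \<le> s"
  shows "\<forall>i\<in>nodes M. U k i \<in> states P"
  using k
proof (induction k rule: less_induct)
  case (less k)
  show ?case
  proof (cases "k = 0")
    case True
    then show ?thesis using U0 by simp
  next
    case False
    then have k: "k \<in> {1..s}" using less.prems by simp
    have c: "\<forall>l<k. 0 \<le> \<alpha> k l \<and> 0 \<le> \<beta> k l \<and> (\<alpha> k l = 0 \<longrightarrow> \<beta> k l = 0)" "(\<Sum>l<k. \<alpha> k l) = 1"
      using ssp k by (auto simp: ssp_coeffs_def)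
    have cv: "convex (states P)" using P by (simp add: conservation_law_def)
    show ?thesis
    proof
      fix i assume i: "i \<in> nodes M"
      have "euler_stage M P (\<beta> k l / \<alpha> k l * \<Delta>t) (U l) i \<in> states P" if l: "l < k" for l
      proof (rule euler_stage_in_states[OF M P less.IH[OF l] i])
        show "l \<le> s" using l k by simp
        have "0 \<le> \<alpha> k l" "0 \<le> \<beta> k l" "\<alpha> k l = 0 \<longrightarrow> \<beta> k l = 0" using c(1) l by auto
        \<comment> \<open>Either the update has step 0 and returns its input, or both weights are
          positive and the step restriction is available.\<close>
        then consider "\<beta> k l = 0" | "\<beta> k l > 0" "\<alpha> k l > 0" by fastforce
        then show "\<beta> k l / \<alpha> k l * \<Delta>t = 0 \<or>
            \<beta> k l / \<alpha> k l * \<Delta>t > 0 \<and> time_step_ok M P (\<beta> k l / \<alpha> k l * \<Delta>t) (U l) i"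
          using step k l i \<Delta>t by cases auto
      qed
      then have "(\<Sum>l<k. \<alpha> k l *\<^sub>R euler_stage M P (\<beta> k l / \<alpha> k l * \<Delta>t) (U l) i) \<in> states P"
        using c by (intro convex_sum[OF _ cv]) auto
      then show "U k i \<in> states P"
        using rk k i by (simp add: ssp_rk_stages_def)
    qed
  qed
qed

theorem theorem3:
  fixes M :: "('d::finite) mesh" and P :: "'d law"
  assumes "CARD('d) \<in> {1, 2, 3}"
    and "fe_mesh M"
    and "conservation_law P"
  shows
    "(\<forall>(u :: nat \<Rightarrow> real) (\<Delta>t :: real).
        (\<forall>i\<in>nodes M. u i \<in> states P) \<and> \<Delta>t > 0 \<longrightarrow>
        (\<forall>i\<in>nodes M. time_step_ok M P \<Delta>t u i \<longrightarrow>
           u_min M u i \<le> euler_stage M P \<Delta>t u i \<and> euler_stage M P \<Delta>t u i \<le> u_max M u i))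
     \<and>
     (\<forall>(s :: nat) (\<alpha> :: nat \<Rightarrow> nat \<Rightarrow> real) (\<beta> :: nat \<Rightarrow> nat \<Rightarrow> real) (\<Delta>t :: real)
        (U :: nat \<Rightarrow> nat \<Rightarrow> real).
        ssp_coeffs s \<alpha> \<beta> \<and> ssp_rk_stages M P s \<alpha> \<beta> \<Delta>t U \<and> \<Delta>t > 0 \<and>
        (\<forall>i\<in>nodes M. U 0 i \<in> states P) \<and>
        (\<forall>k\<in>{1..s}. \<forall>l<k. \<beta> k l > 0 \<longrightarrow>
           (\<forall>i\<in>nodes M. time_step_ok M P (\<beta> k l / \<alpha> k l * \<Delta>t) (U l) i)) \<longrightarrow>
        (\<forall>k\<in>{1..s}. \<forall>l<k. \<beta> k l > 0 \<longrightarrow>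
           (\<forall>i\<in>nodes M.
              u_min M (U l) i \<le> euler_stage M P (\<beta> k l / \<alpha> k l * \<Delta>t) (U l) i \<and>
              euler_stage M P (\<beta> k l / \<alpha> k l * \<Delta>t) (U l) i \<le> u_max M (U l) i)))"
proof (intro conjI allI impI ballI)
  fix u :: "nat \<Rightarrow> real" and \<Delta>t :: real and i
  assume "(\<forall>i\<in>nodes M. u i \<in> states P) \<and> \<Delta>t > 0" "i \<in> nodes M" "time_step_ok M P \<Delta>t u i"
  then show "u_min M u i \<le> euler_stage M P \<Delta>t u i" "euler_stage M P \<Delta>t u i \<le> u_max M u i"
    using euler_stage_bounds[OF assms(2,3)] by auto
next
  fix s :: nat and \<alpha> \<beta> :: "nat \<Rightarrow> nat \<Rightarrow> real" and \<Delta>t :: real and U :: "nat \<Rightarrow> nat \<Rightarrow> real"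
    and k l i
  assume H: "ssp_coeffs s \<alpha> \<beta> \<and> ssp_rk_stages M P s \<alpha> \<beta> \<Delta>t U \<and> \<Delta>t > 0 \<and>
        (\<forall>i\<in>nodes M. U 0 i \<in> states P) \<and>
        (\<forall>k\<in>{1..s}. \<forall>l<k. \<beta> k l > 0 \<longrightarrow>
           (\<forall>i\<in>nodes M. time_step_ok M P (\<beta> k l / \<alpha> k l * \<Delta>t) (U l) i))"
    and k: "k \<in> {1..s}" and l: "l < k" and \<beta>: "\<beta> k l > 0" and i: "i \<in> nodes M"
  have U: "\<forall>i\<in>nodes M. U l i \<in> states P"
    using ssp_rk_stages_in_states[OF assms(2,3), of s \<alpha> \<beta> \<Delta>t U l] H k l by auto
  have "0 \<le> \<alpha> k l" "\<alpha> k l = 0 \<longrightarrow> \<beta> k l = 0" using H k l by (auto simp: ssp_coeffs_def)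
  then have "\<alpha> k l > 0" using \<beta> by (simp add: order_less_le)
  then have "\<beta> k l / \<alpha> k l * \<Delta>t > 0" using \<beta> H by simp
  from euler_stage_bounds[OF assms(2,3) U this i]
  show "u_min M (U l) i \<le> euler_stage M P (\<beta> k l / \<alpha> k l * \<Delta>t) (U l) i"
    and "euler_stage M P (\<beta> k l / \<alpha> k l * \<Delta>t) (U l) i \<le> u_max M (U l) i"
    using H k l \<beta> i by auto
qed

end
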